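(* Let $(\mathbb{X},\|\cdot\|)$ be an even dimensional, smooth and strictly convex real normed space, let $\langle\cdot,\cdot\rangle$ be a symplectic form on $\mathbb{X}$, and let $J$ be the normality map of $(\mathbb{X},\|\cdot\|)$ with respect to $\langle\cdot,\cdot\rangle$, and $J_a$ the corresponding map for the antinorm. Assume that each of $M$, $JM$ and $J_aM^\circ=J_a(M^\circ)$ is a convex body in $\mathbb{X}$ containing the origin $o$ as an interior point. Then \[h_B(M^\circ,x)=g(M,x)\quad\text{and}\quad h_B(JM,x)=g(J_aM^\circ,x)\] for every $x\in\mathbb{X}\setminus\{o\}$.
   Context: All spaces are finite dimensional. With the dual norm $\|f\|^\ast=\sup\{f(x):\|x\|=1\}$ on $\mathbb{X}^\ast$, for $y\in\mathbb{X}$ let $f_y\in\mathbb{X}^\ast$ be the unique functional with $\|f_y\|^\ast=\|y\|$ and $f_y(y)=\|y\|^2$. The semi-inner product induced by the norm is $[x,y]=f_y(x)$, and $F:\mathbb{X}\to\mathbb{X}^\ast$ is $F(y)=f_y$. A symplectic form on $\mathbb{X}$ is a nondegenerate bilinear form with $\langle x,y\rangle=-\langle y,x\rangle$. Let $G:\mathbb{X}\to\mathbb{X}^\ast$ be the linear isomorphism $(Gx)(y)=\langle y,x\rangle$. The antinorm is $\|x\|_a=\sup\{\langle y,x\rangle:\|y\|=1\}$, again a smooth strictly convex norm; $F_a$ is the map obtained from $\|\cdot\|_a$ in the same way as $F$ from $\|\cdot\|$. The normality map is $J=G^{-1}F$, and $J_a=G^{-1}F_a$. For $K\subset\mathbb{X}$,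 the right semi-polar is $K^\circ=\{x\in\mathbb{X}:[x,k]\le1\text{ for all }k\in K\}$. A convex body is a compact convex set with nonempty interior. For a convex body $K$ with $o$ in its interior, the normed support function is $h_B(K,u)=\sup\{[x,u]:x\in K\}$ for $u\ne o$, and the gauge function is $g(K,x)=\min\{\lambda\ge0:x\in\lambda K\}$. *)

theory Defs
  imports "HOL-Analysis.Analysis"
begin

text \<open>
  The norm is a parameter \<open>N\<close> of the definitions, because they are used both for the norm of the
  space and for the antinorm, which lives on the same vector space.  Functionals are functions
  satisfying \<^const>\<open>linear\<close>; in finite dimension every one of them is bounded.
\<close>

definition dual_norm :: "('a::real_vector \<Rightarrow> real) \<Rightarrow> ('a \<Rightarrow> real) \<Rightarrow> real" where
  "dual_norm N f = Sup {f x | x. N x = 1}"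

text \<open>The map \<open>F\<close> sending \<open>y\<close> to \<open>f\<^sub>y\<close>.\<close>

definition duality_map :: "('a::real_vector \<Rightarrow> real) \<Rightarrow> 'a \<Rightarrow> ('a \<Rightarrow> real)" where
  "duality_map N y = (THE f. linear f \<and> dual_norm N f = N y \<and> f y = (N y)\<^sup>2)"

definition sip :: "('a::real_vector \<Rightarrow> real) \<Rightarrow> 'a \<Rightarrow> 'a \<Rightarrow> real" where
  "sip N x y = duality_map N y x"

definition symplectic_form :: "('a::real_vector \<Rightarrow> 'a \<Rightarrow> real) \<Rightarrow> bool" where
  "symplectic_form \<omega> \<longleftrightarrow>
     bilinear \<omega> \<and> (\<forall>x y. \<omega> x y = - \<omega> y x) \<and> (\<forall>x. (\<forall>y. \<omega> x y = 0) \<longrightarrow> x = 0)"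

text \<open>The map \<open>G\<close>; note the order of the arguments.\<close>

definition symplectic_dual :: "('a \<Rightarrow> 'a \<Rightarrow> real) \<Rightarrow> 'a \<Rightarrow> ('a \<Rightarrow> real)" where
  "symplectic_dual \<omega> x = (\<lambda>y. \<omega> y x)"

definition antinorm :: "('a::real_vector \<Rightarrow> real) \<Rightarrow> ('a \<Rightarrow> 'a \<Rightarrow> real) \<Rightarrow> 'a \<Rightarrow> real" where
  "antinorm N \<omega> x = Sup {\<omega> y x | y. N y = 1}"

text \<open>
  \<open>G\<^sup>-\<^sup>1F\<close>.  For symplectic \<open>\<omega>\<close> on a finite-dimensional space \<open>G\<close> is injective with the linear
  functionals as its range, so \<^const>\<open>inv\<close> is only applied where it is a genuine inverse.
\<close>

definition normality_map ::
  "('a::real_vector \<Rightarrow> real) \<Rightarrow> ('a \<Rightarrow> 'a \<Rightarrow> real) \<Rightarrow> 'a \<Rightarrow> 'a" where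
  "normality_map N \<omega> = inv (symplectic_dual \<omega>) \<circ> duality_map N"

definition right_semipolar :: "('a::real_vector \<Rightarrow> real) \<Rightarrow> 'a set \<Rightarrow> 'a set" where
  "right_semipolar N K = {x. \<forall>k\<in>K. sip N x k \<le> 1}"

definition normed_support :: "('a::real_vector \<Rightarrow> real) \<Rightarrow> 'a set \<Rightarrow> 'a \<Rightarrow> real" where
  "normed_support N K u = Sup {sip N x u | x. x \<in> K}"

definition gauge_function :: "'a::real_vector set \<Rightarrow> 'a \<Rightarrow> real" where
  "gauge_function K x = (LEAST t. 0 \<le> t \<and> x \<in> (*\<^sub>R) t ` K)"

definition convex_body :: "'a::real_normed_vector set \<Rightarrow> bool" where
  "convex_body K \<longleftrightarrow> convex K \<and> compact K \<and> interior K \<noteq> {}"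

definition supporting_hyperplane_at ::
  "'a::real_vector set \<Rightarrow> 'a set \<Rightarrow> 'a \<Rightarrow> bool" where
  "supporting_hyperplane_at H K x \<longleftrightarrow>
     (\<exists>f c. linear f \<and> (\<exists>v. f v \<noteq> 0) \<and> H = {y. f y = (c::real)} \<and> x \<in> H \<and> (\<forall>y\<in>K. f y \<le> c))"

definition smooth_space :: "'a::real_normed_vector itself \<Rightarrow> bool" where
  "smooth_space _ \<longleftrightarrow>
     (\<forall>x::'a. norm x = 1 \<longrightarrow> (\<exists>!H. supporting_hyperplane_at H (cball 0 1) x))"

definition strictly_convex_space :: "'a::real_normed_vector itself \<Rightarrow> bool" where
  "strictly_convex_space _ \<longleftrightarrow>
     (\<forall>x y::'a. norm x = 1 \<and> norm y = 1 \<and> x \<noteq> y \<longrightarrow> norm (x + y) < 2)"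

end

theory Submission
  imports Defs
begin

text \<open>
  Everything is moved from functionals to points by means of the symplectic form.  By the
  definition of the normality map \<open>J\<close>, the semi-inner product is \<open>[x, y] = \<omega> x (J y)\<close>
  (\<open>pairing_J\<close>), so the right semi-polar of \<open>M\<close> is the ordinary polar of the convex set \<open>J M\<close> for
  the pairing \<open>\<omega>\<close>, and \<open>h\<^sub>B(M\<degree>, x)\<close> is the ordinary support function of this polar at \<open>J x\<close>.

  The first identity is then the bipolar theorem: the support function of the polar of \<open>J M\<close> is the
  gauge of \<open>J M\<close> (\<open>gauge_function_eq_Sup_polar\<close>).  Since \<open>J\<close> is injective and homogeneous, the gauge
  of \<open>J M\<close> at \<open>J x\<close> is the gauge of \<open>M\<close> at \<open>x\<close>.

  The second identity rests on \<open>J\<^sub>a = - J\<^sup>-\<^sup>1\<close> (\<open>Ja_J\<close>).  It turns \<open>x \<in> t J\<^sub>a M\<degree>\<close> into \<open>- J x \<in> t M\<degree>\<close>,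
  which says that \<open>\<omega> k (J x) \<le> t\<close> for every \<open>k \<in> J M\<close>, that is, \<open>h\<^sub>B(J M, x) \<le> t\<close>.

  Three facts about the space carry this.  Smoothness gives existence and uniqueness of the
  functional \<open>f\<^sub>y\<close> directly, through supporting hyperplanes of the ball.  Compactness of the ball
  makes every functional some \<open>f\<^sub>y\<close>, so that \<open>J\<close> is surjective.  Strict convexity makes \<open>J\<close> injective
  and the functionals for the antinorm unique.  The norm of the type need not come from an inner
  product, so the boundedness of linear functionals and the separation of a point from a
  compact convex set are proved here by means of \<open>\<omega>\<close>.
\<close>

section \<open>Norming functionals\<close>

text \<open>
  The defining conditions of \<open>f\<^sub>y\<close> with the supremum in the dual norm replaced by an inequality at
  every point.  For \<open>y = 0\<close> and a norm \<open>N\<close> it forces \<open>f = 0\<close>.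
\<close>

definition norming_functional :: "('a::real_vector \<Rightarrow> real) \<Rightarrow> ('a \<Rightarrow> real) \<Rightarrow> 'a \<Rightarrow> bool" where
  "norming_functional N f y \<longleftrightarrow> linear f \<and> (\<forall>x. f x \<le> N y * N x) \<and> f y = (N y)\<^sup>2"

text \<open>
  The norm is an arbitrary function \<open>N\<close> so that the equivalence serves the antinorm too.  The
  inequality form bounds the dual norm by \<open>N y\<close>, and evaluation at \<open>y\<close> itself shows that the bound
  is attained.  For \<open>y = 0\<close> the dual norm is nonnegative because of the pair \<open>v\<close>, \<open>- v\<close>.
  Boundedness keeps the supremum from being an arbitrary default value, and
  nontriviality keeps the unit sphere nonempty.
\<close>

lemma dual_norm_conditions_iff:
  fixes N :: "'a::real_vector \<Rightarrow> real"
  assumes homogeneous: "\<And>t x. N (t *\<^sub>R x) = \<bar>t\<bar> * N x"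
    and positive: "\<And>x. x \<noteq> 0 \<Longrightarrow> N x > 0"
    and nontrivial: "\<exists>x::'a. x \<noteq> 0"
    and bounded: "\<And>f :: 'a \<Rightarrow> real. linear f \<Longrightarrow> bdd_above {f x | x. N x = 1}"
  shows "linear f \<and> dual_norm N f = N y \<and> f y = (N y)\<^sup>2 \<longleftrightarrow> norming_functional N f y"
proof -
  have N0: "N 0 = 0"
    using homogeneous[of 0 0] by simp
  have normalise: "N ((1 / N x) *\<^sub>R x) = 1" if "x \<noteq> 0" for x
    using positive[OF that] by (simp add: homogeneous)
  have le_dual: "f x \<le> dual_norm N f * N x" if "linear f" for x
  proof (cases "x = 0")
    case True
    then show ?thesis using that N0 by (simp add: linear_0)
  next
    case False
    have "f ((1 / N x) *\<^sub>R x) \<le> dual_norm N f"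
      unfolding dual_norm_def using normalise[OF False]
      by (intro cSup_upper bounded[OF that]) blast
    then show ?thesis
      using positive[OF False] that by (simp add: linear_scale field_simps)
  qed
  have dual_eq: "dual_norm N f = N y" if f: "norming_functional N f y"
  proof (rule antisym)
    obtain v :: 'a where v: "v \<noteq> 0" using nontrivial by blast
    have "f x \<le> N y" if "N x = 1" for x
      using f that unfolding norming_functional_def by (metis mult.right_neutral)
    then show "dual_norm N f \<le> N y"
      unfolding dual_norm_def using normalise[OF v] by (intro cSup_least) auto
    have lin: "linear f" using f by (simp add: norming_functional_def)
    show "N y \<le> dual_norm N f"
    proof (cases "y = 0")
      case False
      have "N y * N y \<le> dual_norm N f * N y"
        using le_dual[OF lin, of y] f by (simp add: norming_functional_def power2_eq_square)
      then show ?thesis using positive[OF False] by simp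
    next
      case True
      have "0 \<le> dual_norm N f" 
      proof -
        have "N (- v) = N v" using homogeneous[of "-1" v] by simp
        then have "f (- v) \<le> dual_norm N f * N v"
          using le_dual[OF lin, of "-v"] by metis
        then have "0 \<le> dual_norm N f * N v"
          using le_dual[OF lin, of v] linear_neg[OF lin, of v] by linarith
        then show ?thesis using positive[OF v] by (simp add: zero_le_mult_iff)
      qed
      then show ?thesis using True N0 by simp
    qed
  qed
  show ?thesis
    using le_dual dual_eq unfolding norming_functional_def by metis
qed

lemma duality_map_eqI:
  fixes N :: "'a::real_vector \<Rightarrow> real"
  assumes "\<And>t x. N (t *\<^sub>R x) = \<bar>t\<bar> * N x"
    and "\<And>x. x \<noteq> 0 \<Longrightarrow> N x > 0"
    and "\<exists>x::'a. x \<noteq> 0"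
    and "\<And>f :: 'a \<Rightarrow> real. linear f \<Longrightarrow> bdd_above {f x | x. N x = 1}"
    and f: "norming_functional N f y"
    and unique: "\<And>g. norming_functional N g y \<Longrightarrow> g = f"
  shows "duality_map N y = f"
proof -
  have "duality_map N y = (THE g. norming_functional N g y)"
    unfolding duality_map_def
    by (rule arg_cong[where f = The], rule ext, rule dual_norm_conditions_iff[OF assms(1-4)])
  also have "\<dots> = f"
    using f unique by (rule the_equality)
  finally show ?thesis .
qed

lemma norming_functional_scale:
  assumes "norming_functional norm f y"
  shows "norming_functional norm (\<lambda>x. t * f x) (t *\<^sub>R y)"
proof -
  have lin: "linear f" and le: "\<And>x. f x \<le> norm y * norm x" and fy: "f y = (norm y)\<^sup>2"
    using assms by (auto simp: norming_functional_def)
  have "\<bar>f x\<bar> \<le> norm y * norm x" for x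
    using le[of x] le[of "-x"] linear_neg[OF lin, of x] by auto
  then have "t * f x \<le> \<bar>t\<bar> * norm y * norm x" for x
    by (metis abs_ge_self abs_mult abs_ge_zero mult_left_mono order_trans mult.assoc)
  moreover have "linear (\<lambda>x. t * f x)"
    using linear_compose_scale_right[OF lin, of t] by simp
  ultimately show ?thesis
    using lin fy by (simp add: norming_functional_def linear_scale power2_eq_square)
qed

text \<open>
  This links norming functionals to the supporting hyperplanes in the definition of smoothness, so
  that uniqueness of the hyperplane becomes uniqueness of the functional.
\<close>

lemma norming_functional_supports:
  assumes f: "norming_functional norm f x" and x: "norm x = 1"
  shows "supporting_hyperplane_at {y. f y = 1} (cball 0 1) x"
proof -
  have lin: "linear f" and le: "\<And>y. f y \<le> norm y" and fx: "f x = 1"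
    using f x by (auto simp: norming_functional_def)
  have "\<forall>y\<in>cball 0 1. f y \<le> 1"
    using le order_trans by fastforce
  then show ?thesis
    unfolding supporting_hyperplane_at_def
    using lin fx by (intro exI[of _ f] exI[of _ 1]) (auto intro: exI[of _ x])
qed

text \<open>
  Off the kernel, a vector can be rescaled into the level set; on the kernel, it can be added to a
  point of the level set without leaving it.
\<close>

lemma linear_eq_of_level_set_eq:
  fixes f g :: "'a::real_vector \<Rightarrow> real"
  assumes f: "linear f" and g: "linear g" and x: "f x = 1"
    and eq: "{y. f y = 1} = {y. g y = 1}"
  shows "f = g"
proof
  fix z
  have iff: "f y = 1 \<longleftrightarrow> g y = 1" for y
    using eq by blast
  show "f z = g z"
  proof (cases "f z = 0")
    case True
    then show ?thesis
      using iff[of "x + z"] iff[of x] x by (simp add: linear_add[OF f] linear_add[OF g])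
  next
    case False
    then show ?thesis
      using iff[of "(1 / f z) *\<^sub>R z"] by (simp add: linear_scale[OF f] linear_scale[OF g] field_simps)
  qed
qed

text \<open>
  Smoothness asserts that a supporting hyperplane exists at each unit vector; the functional of
  that hyperplane, scaled so that its level is 1, norms the unit vector.
\<close>

lemma smooth_space_ex_norming_functional:
  fixes y :: "'a::real_normed_vector"
  assumes "smooth_space TYPE('a)"
  shows "\<exists>f. norming_functional norm f y"
proof (cases "y = 0")
  case True
  have "linear (\<lambda>x::'a. 0::real)" by (rule linear_zero)
  then show ?thesis
    using True by (intro exI[of _ "\<lambda>x. 0"]) (simp add: norming_functional_def)
next
  case False
  define x where "x = (1 / norm y) *\<^sub>R y"
  have x: "norm x = 1" using False by (simp add: x_def)
  obtain H where "supporting_hyperplane_at H (cball 0 1) x"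
    using assms x unfolding smooth_space_def by blast
  then obtain f c v where f: "linear f" and v: "f v \<noteq> 0" and fx: "f x = (c::real)"
    and le: "\<And>z. z \<in> cball 0 1 \<Longrightarrow> f z \<le> c"
    unfolding supporting_hyperplane_at_def by force
  have fle: "f z \<le> c * norm z" for z
  proof (cases "z = 0")
    case True
    then show ?thesis using f by (simp add: linear_0)
  next
    case False
    then have "f ((1 / norm z) *\<^sub>R z) \<le> c" by (intro le) simp
    then show ?thesis using False by (simp add: linear_scale[OF f] field_simps)
  qed
  have "v \<noteq> 0" using v f linear_0 by blast
  then have c: "c > 0"
    using fle[of v] fle[of "-v"] v linear_neg[OF f, of v]
    by (smt (verit) norm_minus_cancel zero_less_norm_iff mult_nonneg_nonneg mult_le_0_iff)
  have "linear (\<lambda>z. (1 / c) * f z)"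
    using linear_compose_scale_right[OF f, of "1 / c"] by simp
  then have "norming_functional norm (\<lambda>z. (1 / c) * f z) x"
    using fle c x fx by (simp add: norming_functional_def field_simps)
  from norming_functional_scale[OF this, of "norm y"] False show ?thesis
    by (auto simp: x_def)
qed

lemma smooth_space_norming_functional_unique:
  fixes y :: "'a::real_normed_vector"
  assumes smooth: "smooth_space TYPE('a)"
    and f: "norming_functional norm f y" and g: "norming_functional norm g y"
  shows "f = g"
proof (cases "y = 0")
  case True
  have "h x = 0" if "norming_functional norm h y" for h and x :: 'a
  proof -
    have "linear h" "h x \<le> 0" "h (-x) \<le> 0"
      using that True by (auto simp: norming_functional_def)
    then show ?thesis by (simp add: linear_neg)
  qed
  then show ?thesis using f g by (metis ext)
next
  case False
  let ?t = "1 / norm y"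
  let ?x = "?t *\<^sub>R y"
  have x: "norm ?x = 1" using False by simp
  have f': "norming_functional norm (\<lambda>z. ?t * f z) ?x" and g': "norming_functional norm (\<lambda>z. ?t * g z) ?x"
    using norming_functional_scale[OF f, of ?t] norming_functional_scale[OF g, of ?t] by simp_all
  have "{z. ?t * f z = 1} = {z. ?t * g z = 1}"
    using norming_functional_supports[OF f' x] norming_functional_supports[OF g' x] smooth x
    unfolding smooth_space_def by blast
  then have "(\<lambda>z. ?t * f z) = (\<lambda>z. ?t * g z)"
    using f' g' x by (intro linear_eq_of_level_set_eq[where x = ?x]) (auto simp: norming_functional_def)
  then have "?t * f z = ?t * g z" for z
    by (rule fun_cong)
  then show ?thesis using False by (intro ext) simp
qed

text \<open>
  A functional cannot attain its norm at two different points of a sphere: it would then attain it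
  at their midpoint too, and the midpoint would lie on the sphere.
\<close>

lemma strictly_convex_norming_point_unique:
  fixes y u :: "'a::real_normed_vector"
  assumes strict: "strictly_convex_space TYPE('a)"
    and f: "norming_functional norm f y" and u: "f u = (norm y)\<^sup>2" "norm u \<le> norm y"
  shows "u = y"
proof (cases "y = 0")
  case True
  then show ?thesis using u by simp
next
  case False
  have le: "\<And>x. f x \<le> norm y * norm x" and lin: "linear f" and fy: "f y = (norm y)\<^sup>2"
    using f by (auto simp: norming_functional_def)
  have "norm y * norm y \<le> norm y * norm u"
    using le[of u] u by (simp add: power2_eq_square)
  then have nu: "norm u = norm y" using u False by simp
  let ?t = "1 / norm y"
  have "norm y * (2 * norm y) \<le> norm y * norm (u + y)"
    using le[of "u + y"] u fy by (simp add: linear_add[OF lin] power2_eq_square)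
  then have "2 \<le> norm (u + y) / norm y"
    using False by (simp add: field_simps)
  also have "\<dots> = norm (?t *\<^sub>R u + ?t *\<^sub>R y)"
    by (simp flip: scaleR_add_right)
  finally have "\<not> norm (?t *\<^sub>R u + ?t *\<^sub>R y) < 2" by simp
  then have "?t *\<^sub>R u = ?t *\<^sub>R y"
    using strict nu False unfolding strictly_convex_space_def
    by (metis (no_types, lifting) divide_self_if norm_eq_zero norm_scaleR abs_norm_cancel abs_divide abs_one times_divide_eq_left mult_1)
  then show ?thesis using False by simp
qed

section \<open>Gauge functions\<close>

text \<open>
  A criterion that avoids scaling by 0: since \<open>x \<noteq> 0\<close>, the value \<open>t = 0\<close> never competes for the
  minimum.
\<close>

lemma gauge_function_eqI:
  assumes x: "x \<noteq> 0" and s: "s > 0"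
    and iff: "\<And>t. t > 0 \<Longrightarrow> (1 / t) *\<^sub>R x \<in> K \<longleftrightarrow> s \<le> t"
  shows "gauge_function K x = s"
proof -
  have mem: "0 \<le> t \<and> x \<in> (*\<^sub>R) t ` K \<longleftrightarrow> s \<le> t" for t
  proof (cases "t > 0")
    case True
    then have "x \<in> (*\<^sub>R) t ` K \<longleftrightarrow> (1 / t) *\<^sub>R x \<in> K"
      by (auto simp: image_iff intro!: bexI[of _ "(1 / t) *\<^sub>R x"])
    then show ?thesis using iff True by auto
  next
    case False
    then show ?thesis using x s by (cases "t = 0") auto
  qed
  show ?thesis
    unfolding gauge_function_def mem by (rule Least_equality) auto
qed

lemma compact_cball_of_compact_neighbourhood:
  fixes M :: "'a::real_normed_vector set"
  assumes "compact M" "0 \<in> interior M"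
  shows "compact (cball (0::'a) 1)"
proof -
  obtain e where e: "e > 0" "cball 0 e \<subseteq> M"
    using assms(2) by (meson mem_interior_cball)
  then have "compact (cball (0::'a) e)"
    using compact_Int_closed[OF assms(1) closed_cball, of 0 e] by (simp add: Int_absorb1)
  then have "compact ((*\<^sub>R) (1 / e) ` cball (0::'a) e)"
    by (rule compact_scaling)
  also have "(*\<^sub>R) (1 / e) ` cball (0::'a) e = cball 0 1"
    using cball_scale[of "1 / e" 0 e] e by simp
  finally show ?thesis .
qed

section \<open>Functionals on a smooth symplectic normed space\<close>

text \<open>
  Finite dimension enters in two forms, as a finite spanning set, for the linear algebra, and as
  compactness of the unit ball, for extremal points.
\<close>

locale symplectic_minkowski_space =
  fixes \<omega> :: "'a::real_normed_vector \<Rightarrow> 'a \<Rightarrow> real"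
  assumes finite_dimensional: "\<exists>B::'a set. finite B \<and> span B = UNIV"
    and smooth: "smooth_space TYPE('a)"
    and strictly_convex: "strictly_convex_space TYPE('a)"
    and symplectic: "symplectic_form \<omega>"
    and compact_ball: "compact (cball (0::'a) 1)"
    and nontrivial: "\<exists>x::'a. x \<noteq> 0"
begin

lemma bilinear: "bilinear \<omega>" and skew: "\<omega> x y = - \<omega> y x"
  and nondegenerate: "(\<And>y. \<omega> x y = 0) \<Longrightarrow> x = 0"
  using symplectic unfolding symplectic_form_def by blast+

lemma linear_left: "linear (\<lambda>x. \<omega> x u)" and linear_right: "linear (\<omega> u)"
  using bilinear by (auto simp: bilinear_def)

lemma nondegenerate_right: "(\<And>x. \<omega> x u = 0) \<Longrightarrow> u = 0"
  using nondegenerate skew by (metis neg_0_equal_iff_equal)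

lemma inj_symplectic_dual: "inj (symplectic_dual \<omega>)"
proof (rule injI)
  fix u v assume "symplectic_dual \<omega> u = symplectic_dual \<omega> v"
  then have "\<omega> x (u - v) = 0" for x
    by (simp add: symplectic_dual_def bilinear_rsub[OF bilinear] fun_eq_iff)
  then show "u = v" using nondegenerate_right[of "u - v"] by simp
qed

lemma finite_basis:
  obtains B :: "'a set" where "finite B" "independent B" "span B = UNIV"
proof -
  obtain A :: "'a set" where A: "finite A" "span A = UNIV"
    using finite_dimensional by blast
  obtain B where B: "B \<subseteq> A" "independent B" "A \<subseteq> span B"
    by (rule maximal_independent_subset)
  then have "span B = UNIV"
    using A by (metis span_minimal subspace_span top.extremum_uniqueI)
  then show thesis using that B A finite_subset by blast
qed

lemma zero_of_pairing_basis_zero: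
  assumes "span B = UNIV" "\<And>b. b \<in> B \<Longrightarrow> \<omega> b u = 0"
  shows "u = 0"
proof (rule nondegenerate_right)
  fix x
  have "x \<in> span B" using assms by simp
  then show "\<omega> x u = 0"
    using linear_eq_on_span[OF linear_left linear_zero, of B u] assms(2) by auto
qed

text \<open>
  The map \<open>u \<mapsto> (\<Sum>b\<in>B. \<omega> b u *\<^sub>R b)\<close> for a basis \<open>B\<close> is injective because the form is nondegenerate.  As
  an endomorphism of a finite-dimensional space it is then surjective, so the values
  \<open>\<omega> b u\<close> on the basis can be prescribed.
\<close>

lemma linear_functional_representation:
  fixes f :: "'a \<Rightarrow> real"
  assumes f: "linear f"
  obtains u where "f = (\<lambda>x. \<omega> x u)"
proof -
  obtain B :: "'a set" where B: "finite B" "independent B" "span B = UNIV"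
    by (rule finite_basis)
  interpret finite_dimensional_vector_space_pair "scaleR :: real \<Rightarrow> 'a \<Rightarrow> 'a" B
    "scaleR :: real \<Rightarrow> 'a \<Rightarrow> 'a" B
    by unfold_locales (use B in \<open>auto simp: dependent_raw_def span_raw_def\<close>)
  define \<phi> where "\<phi> u = (\<Sum>b\<in>B. \<omega> b u *\<^sub>R b)" for u
  have coeff: "c b = d b" if "(\<Sum>b\<in>B. c b *\<^sub>R b) = (\<Sum>b\<in>B. d b *\<^sub>R b)" "b \<in> B" for c d b
  proof -
    have "(\<Sum>b\<in>B. (c b - d b) *\<^sub>R b) = 0"
      using that by (simp add: scaleR_diff_left sum_subtractf)
    then have "c b - d b = 0"
      using independentD[OF B(2) B(1) subset_refl] that(2) by fast
    then show ?thesis by simp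
  qed
  have "linear \<phi>"
    unfolding \<phi>_def
    by (intro linearI) (simp_all add: bilinear_radd[OF bilinear] bilinear_rmul[OF bilinear]
        scaleR_add_left sum.distrib scaleR_sum_right)
  moreover have "inj \<phi>"
  proof (rule linear_injective_0[THEN iffD2, OF \<open>linear \<phi>\<close>], intro allI impI)
    fix u assume "\<phi> u = 0"
    then have "\<omega> b u = 0" if "b \<in> B" for b
      using coeff[of "\<lambda>b. \<omega> b u" "\<lambda>_. 0"] that by (simp add: \<phi>_def)
    then show "u = 0" using zero_of_pairing_basis_zero[OF B(3)] by blast
  qed
  ultimately have "surj \<phi>"
    by (intro linear_injective_imp_surjective) (auto simp: linear_def)
  then obtain u where "\<phi> u = (\<Sum>b\<in>B. f b *\<^sub>R b)"
    by (metis surjD)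
  then have "\<omega> b u = f b" if "b \<in> B" for b
    using coeff[of "\<lambda>b. \<omega> b u" f] that by (simp add: \<phi>_def)
  then have "f x = \<omega> x u" for x
    using linear_eq_on_span[OF f linear_left, of B u x] B(3) by simp
  then show thesis using that by blast
qed

text \<open>
  If \<open>C\<close> is a basis of \<open>U\<close> and \<open>a \<notin> U\<close>, then \<open>insert a C\<close> is independent, so some functional vanishes on
  \<open>U\<close> but not at \<open>a\<close>; its representing vector is \<open>v\<close>.
\<close>

lemma proper_subspace_annihilator:
  assumes U: "subspace U" "U \<noteq> UNIV"
  obtains v where "v \<noteq> 0" "\<And>u. u \<in> U \<Longrightarrow> \<omega> v u = 0"
proof -
  obtain C where C: "C \<subseteq> U" "independent C" "U \<subseteq> span C"
    by (rule maximal_independent_subset)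
  obtain a where a: "a \<notin> U" using U by blast
  have "a \<notin> span C" using a C U by (metis in_mono span_minimal)
  then have ind: "independent (insert a C)" using C by (intro independent_insertI)
  obtain f :: "'a \<Rightarrow> real" where f: "linear f" "\<forall>x\<in>insert a C. f x = (if x = a then 1 else 0)"
    using linear_independent_extend[OF ind, of "\<lambda>x. if x = a then 1 else 0 :: real"] by blast
  have "f x = 0" if "x \<in> U" for x
  proof (rule linear_eq_on_span[OF f(1) linear_zero])
    show "f b = 0" if "b \<in> C" for b using f(2) C(1) a that by auto
    show "x \<in> span C" using C(3) that by blast
  qed
  moreover obtain v where v: "f = (\<lambda>x. \<omega> x v)"
    by (rule linear_functional_representation[OF f(1)])
  moreover have "v \<noteq> 0"
    using f(2) bilinear_rzero[OF bilinear, of a] v by auto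
  ultimately show thesis
    using that skew by (metis neg_0_equal_iff_equal)
qed

text \<open>
  The functionals \<open>\<omega> _ u\<close> that are bounded form a subspace \<open>U\<close> of vectors \<open>u\<close>.  If \<open>U\<close> were proper, some
  \<open>v \<noteq> 0\<close> would be annihilated by all of these functionals; but the norming functional of \<open>v\<close> is
  one of them, and its value at \<open>v\<close> is positive.
\<close>

lemma linear_functional_bounded:
  fixes f :: "'a \<Rightarrow> real"
  assumes f: "linear f"
  shows "bounded_linear f"
proof -
  define U where "U = {u. bounded_linear (\<lambda>x. \<omega> x u)}"
  have "subspace U"
    unfolding subspace_def U_def
    by (auto simp: bilinear_rzero[OF bilinear] bilinear_radd[OF bilinear] bilinear_rmul[OF bilinear]
        bounded_linear_zero intro: bounded_linear_add bounded_linear_const_mult)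
  have "U = UNIV"
  proof (rule ccontr)
    assume "U \<noteq> UNIV"
    then obtain v where v: "v \<noteq> 0" "\<And>u. u \<in> U \<Longrightarrow> \<omega> v u = 0"
      using proper_subspace_annihilator[OF \<open>subspace U\<close>] by blast
    obtain g where g: "norming_functional norm g v"
      using smooth_space_ex_norming_functional[OF smooth] by blast
    then have lin: "linear g" and le: "\<And>x. g x \<le> norm v * norm x"
      by (auto simp: norming_functional_def)
    have "norm (g x) \<le> norm x * norm v" for x
      using le[of x] le[of "-x"] linear_neg[OF lin, of x] by (auto simp: mult.commute)
    then have "bounded_linear g"
      using lin by (intro bounded_linear_intro[where K = "norm v"])
        (auto simp: linear_add linear_scale)
    moreover obtain u where "g = (\<lambda>x. \<omega> x u)"
      by (rule linear_functional_representation[OF lin])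
    ultimately have "g v = 0" using v(2)[of u] by (simp add: U_def)
    then show False using g v(1) by (simp add: norming_functional_def)
  qed
  moreover obtain u where "f = (\<lambda>x. \<omega> x u)"
    by (rule linear_functional_representation[OF f])
  ultimately show ?thesis by (auto simp: U_def)
qed

lemma linear_functional_continuous:
  fixes f :: "'a \<Rightarrow> real"
  assumes "linear f"
  shows "continuous_on S f"
  using linear_functional_bounded[OF assms] by (rule linear_continuous_on)

lemma linear_functional_bdd_above:
  fixes f :: "'a \<Rightarrow> real"
  assumes "linear f" "bounded S"
  shows "bdd_above {f x | x. x \<in> S}"
  using bounded_linear_image[OF assms(2) linear_functional_bounded[OF assms(1)]]
  unfolding Setcompr_eq_image by (rule bounded_imp_bdd_above)

lemma bdd_above_unit_sphere:
  fixes f :: "'a \<Rightarrow> real"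
  assumes "linear f"
  shows "bdd_above {f x | x. norm x = 1}"
  using linear_functional_bdd_above[OF assms bounded_subset[OF bounded_cball sphere_cball], of 0 1]
  by (simp add: dist_norm)

text \<open>
  The usual projection argument, for an auxiliary Euclidean structure: pairing with a basis embeds
  the space linearly into a coordinate space, and \<open>ip\<close> is the pulled-back dot product.  The
  separating functional is the inner product with \<open>q - p\<close>, where \<open>p\<close> is the point of \<open>K\<close>
  nearest to \<open>q\<close>.
\<close>

lemma separation_compact_convex:
  fixes K :: "'a set"
  assumes K: "convex K" "compact K" "K \<noteq> {}" and q: "q \<notin> K"
  obtains f :: "'a \<Rightarrow> real" and c where "linear f" "\<And>k. k \<in> K \<Longrightarrow> f k \<le> c" "c < f q"
proof -
  obtain B :: "'a set" where B: "finite B" "independent B" "span B = UNIV"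
    by (rule finite_basis)
  define ip where "ip x y = (\<Sum>b\<in>B. \<omega> b x * \<omega> b y)" for x y
  have lin: "linear (ip x)" for x
    unfolding ip_def
    by (intro linearI) (simp_all add: bilinear_radd[OF bilinear] bilinear_rmul[OF bilinear]
        sum.distrib sum_distrib_left algebra_simps)
  have sym: "ip x y = ip y x" for x y
    by (simp add: ip_def mult.commute)
  have ip_diff_left: "ip (x - y) z = ip x z - ip y z" for x y z
    using linear_diff[OF lin, of z x y] sym[of z "x - y"] sym[of z x] sym[of z y] by simp
  have ip_expand: "ip (x + t *\<^sub>R h) (x + t *\<^sub>R h) = ip x x + 2 * t * ip x h + t * t * ip h h" for x h t
  proof -
    have "ip (x + t *\<^sub>R h) z = ip x z + t * ip h z" for z
      using sym[of z "x + t *\<^sub>R h"] sym[of z x] sym[of z h]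
      by (simp add: linear_add[OF lin] linear_scale[OF lin])
    then show ?thesis
      using sym[of x h] by (simp add: linear_add[OF lin] linear_scale[OF lin] algebra_simps)
  qed
  have pos: "ip x x > 0" if "x \<noteq> 0" for x
  proof -
    have "\<exists>b\<in>B. \<omega> b x \<noteq> 0"
      using zero_of_pairing_basis_zero[OF B(3), of x] that by auto
    then obtain b where "b \<in> B" "\<omega> b x \<noteq> 0" ..
    then show ?thesis
      unfolding ip_def using B(1) by (intro sum_pos2[of B b]) (auto simp: zero_less_mult_iff)
  qed
  \<comment> \<open>This is the squared distance of \<open>k\<close> from \<open>q\<close> up to the constant \<open>ip q q\<close>.\<close>
  have cont: "continuous_on K (\<lambda>k. ip k k - 2 * ip q k)"
    unfolding ip_def
    by (intro continuous_intros linear_functional_continuous linear_right)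
  obtain p where p: "p \<in> K" and min: "\<And>k. k \<in> K \<Longrightarrow> ip p p - 2 * ip q p \<le> ip k k - 2 * ip q k"
    using continuous_attains_inf[OF K(2,3) cont] by blast
  let ?d = "q - p"
  have "ip ?d k \<le> ip ?d p" if k: "k \<in> K" for k
  proof -
    define h where "h = k - p"
    \<comment> \<open>Moving from the nearest point towards \<open>k\<close> does not decrease the distance from \<open>q\<close>.\<close>
    have step: "ip ?d h \<le> t * ip h h / 2" if t: "0 < t" "t \<le> 1" for t
    proof -
      have "p + t *\<^sub>R h = (1 - t) *\<^sub>R p + t *\<^sub>R k"
        by (simp add: h_def algebra_simps)
      also have "\<dots> \<in> K"
        using K(1) p k t by (intro convexD) auto
      finally have "ip p p - 2 * ip q p \<le> ip (p + t *\<^sub>R h) (p + t *\<^sub>R h) - 2 * ip q (p + t *\<^sub>R h)"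
        by (rule min)
      also have "\<dots> = ip p p - 2 * ip q p - 2 * t * ip ?d h + t * t * ip h h"
        unfolding ip_expand
        by (simp add: ip_diff_left linear_add[OF lin] linear_scale[OF lin] algebra_simps)
      finally have "t * (2 * ip ?d h) \<le> t * (t * ip h h)"
        by (simp add: algebra_simps)
      then show ?thesis using t by simp
    qed
    have "((\<lambda>t. t * ip h h / 2) \<longlongrightarrow> 0 * ip h h / 2) (at_right 0)"
      by (intro tendsto_intros) auto
    moreover have "\<forall>\<^sub>F t in at_right (0::real). ip ?d h \<le> t * ip h h / 2"
      using step by (intro eventually_at_rightI[of 0 1]) auto
    ultimately have "ip ?d h \<le> 0 * ip h h / 2"
      by (intro tendsto_lowerbound) auto
    then show ?thesis by (simp add: h_def linear_diff[OF lin])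
  qed
  moreover have "ip ?d p < ip ?d q"
    using pos[of ?d] p q by (auto simp: linear_diff[OF lin])
  ultimately show thesis using that lin by blast
qed

text \<open>
  A nonzero functional attains a positive maximum on the compact ball at some unit vector; that
  vector, scaled by the maximum, is the point whose norming functional is \<open>f\<close>.
\<close>

lemma ex_norming_point:
  fixes f :: "'a \<Rightarrow> real"
  assumes f: "linear f"
  obtains y where "norming_functional norm f y"
proof (cases "f = (\<lambda>x. 0)")
  case True
  then have "norming_functional norm f 0"
    using f by (simp add: norming_functional_def)
  then show thesis by (rule that)
next
  case False
  then obtain v where "f v \<noteq> 0" by auto
  have "continuous_on (cball 0 1) f"
    by (rule linear_functional_continuous[OF f])
  then obtain x where x: "norm x \<le> 1" and max: "\<And>z. norm z \<le> 1 \<Longrightarrow> f z \<le> f x"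
    using continuous_attains_sup[OF compact_ball, of f] by auto
  have le: "f z \<le> f x * norm z" for z
  proof (cases "z = 0")
    case True
    then show ?thesis using f by (simp add: linear_0)
  next
    case False
    then show ?thesis
      using max[of "(1 / norm z) *\<^sub>R z"] by (simp add: linear_scale[OF f] field_simps)
  qed
  have "v \<noteq> 0" using \<open>f v \<noteq> 0\<close> f linear_0 by blast
  then have pos: "f x > 0"
    using le[of v] le[of "-v"] \<open>f v \<noteq> 0\<close> linear_neg[OF f, of v]
    by (smt (verit) norm_minus_cancel zero_less_norm_iff mult_nonneg_nonneg mult_le_0_iff)
  then have "norm x = 1" using le[of x] x by auto
  then have "norming_functional norm f (f x *\<^sub>R x)"
    using f le pos by (simp add: norming_functional_def linear_scale power2_eq_square)
  then show thesis by (rule that)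
qed

section \<open>The normality map\<close>

abbreviation J :: "'a \<Rightarrow> 'a" where
  "J \<equiv> normality_map norm \<omega>"

lemma norming_functional_duality_map:
  fixes y :: 'a
  shows "norming_functional norm (duality_map norm y) y"
proof -
  obtain f where f: "norming_functional norm f y"
    using smooth_space_ex_norming_functional[OF smooth] by blast
  have "duality_map norm y = f"
    by (rule duality_map_eqI)
      (auto intro: f nontrivial bdd_above_unit_sphere smooth_space_norming_functional_unique[OF smooth _ f])
  then show ?thesis using f by simp
qed

text \<open>
  All further properties of \<open>J\<close> are read off from this identity.  The inverse in the
  definition of \<open>J\<close> is genuine here because \<open>f\<^sub>y\<close> is in the range of \<open>G\<close>.
\<close>

lemma pairing_J: "\<omega> x (J y) = sip norm x y"
proof -
  have "linear (duality_map norm y)"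
    using norming_functional_duality_map[of y] by (simp add: norming_functional_def)
  then obtain u where "duality_map norm y = (\<lambda>x. \<omega> x u)"
    by (rule linear_functional_representation)
  then have u: "duality_map norm y = symplectic_dual \<omega> u"
    by (simp add: symplectic_dual_def)
  then have "J y = u"
    by (simp add: normality_map_def inv_f_f[OF inj_symplectic_dual])
  then show ?thesis using u by (simp add: sip_def symplectic_dual_def)
qed

lemma norming_functional_J: "norming_functional norm (\<lambda>x. \<omega> x (J y)) y"
  using norming_functional_duality_map[of y] by (simp add: pairing_J sip_def)

lemma pairing_J_self: "\<omega> y (J y) = (norm y)\<^sup>2"
  using norming_functional_J[of y] by (simp add: norming_functional_def)

lemma pairing_J_le: "\<omega> x (J y) \<le> norm y * norm x"
  using norming_functional_J[of y] by (simp add: norming_functional_def)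

lemma J_eqI:
  assumes "norming_functional norm (\<lambda>x. \<omega> x u) y"
  shows "J y = u"
  using smooth_space_norming_functional_unique[OF smooth norming_functional_J assms]
    inj_symplectic_dual by (auto simp: symplectic_dual_def inj_def)

lemma J_scale: "J (t *\<^sub>R y) = t *\<^sub>R J y"
  using norming_functional_scale[OF norming_functional_J, of t y]
  by (intro J_eqI) (simp add: bilinear_rmul[OF bilinear])

lemma J_nonzero: "y \<noteq> 0 \<Longrightarrow> J y \<noteq> 0"
  using pairing_J_self[of y] bilinear_rzero[OF bilinear, of y] by auto

lemma surj_J: "surj J"
proof -
  have "\<exists>y. u = J y" for u
    using ex_norming_point[OF linear_left, of u] J_eqI by metis
  then show ?thesis by (simp add: surj_def)
qed

text \<open>
  If \<open>J x = J y\<close>, one functional norms both points.  Evaluating it at each of them gives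
  \<open>norm x = norm y\<close>, and strict convexity does the rest.
\<close>

lemma inj_J: "inj J"
proof (rule injI)
  fix x y assume eq: "J x = J y"
  have "norm x * norm x \<le> norm x * norm y" "norm y * norm y \<le> norm y * norm x"
    using pairing_J_self[of x] pairing_J_self[of y] pairing_J_le[of x y] pairing_J_le[of y x] eq
    by (simp_all add: power2_eq_square mult.commute)
  then have norms: "norm x = norm y"
    by (cases "x = 0"; cases "y = 0") (auto simp: mult_le_0_iff)
  then show "x = y"
    using strictly_convex_norming_point_unique[OF strictly_convex norming_functional_J, of x y]
      pairing_J_self[of x] eq by simp
qed

lemma mem_symplectic_polar_iff: "y \<in> right_semipolar norm M \<longleftrightarrow> (\<forall>k\<in>J ` M. \<omega> y k \<le> 1)"
  by (auto simp: right_semipolar_def pairing_J)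

section \<open>The normality map of the antinorm\<close>

abbreviation Ja :: "'a \<Rightarrow> 'a" where
  "Ja \<equiv> normality_map (antinorm norm \<omega>) \<omega>"

text \<open>
  The antinorm of \<open>J y\<close> is the dual norm of \<open>f\<^sub>y\<close>.  As \<open>J\<close> is surjective, the norm axioms for the
  antinorm that are needed below are inherited from the norm through this identity.
\<close>

lemma antinorm_J: "antinorm norm \<omega> (J y) = norm y"
proof -
  have "dual_norm norm (\<lambda>x. \<omega> x (J y)) = norm y"
    using dual_norm_conditions_iff[of "norm :: 'a \<Rightarrow> real" "\<lambda>x. \<omega> x (J y)" y,
        OF _ _ nontrivial bdd_above_unit_sphere] norming_functional_J[of y] by simp
  then show ?thesis by (simp add: dual_norm_def antinorm_def)
qed

lemma antinorm_homogeneous: "antinorm norm \<omega> (t *\<^sub>R u) = \<bar>t\<bar> * antinorm norm \<omega> u"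
proof -
  obtain y where "u = J y" using surj_J by blast
  then show ?thesis
    using antinorm_J[of "t *\<^sub>R y"] by (simp add: antinorm_J J_scale)
qed

lemma antinorm_positive: "u \<noteq> 0 \<Longrightarrow> antinorm norm \<omega> u > 0"
proof -
  assume "u \<noteq> 0"
  obtain y where y: "u = J y" using surj_J by blast
  then have "y \<noteq> 0" using \<open>u \<noteq> 0\<close> J_scale[of 0 0] by auto
  then show ?thesis by (simp add: y antinorm_J)
qed

lemma pairing_le_antinorm: "\<omega> v u \<le> norm v * antinorm norm \<omega> u"
proof -
  obtain y where "u = J y" using surj_J by blast
  then show ?thesis using pairing_J_le[of v y] by (simp add: antinorm_J mult.commute)
qed

lemma linear_functional_representation_left:
  fixes f :: "'a \<Rightarrow> real"
  assumes "linear f"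
  obtains u where "f = \<omega> u"
proof -
  obtain v where "f = (\<lambda>x. \<omega> x v)"
    by (rule linear_functional_representation[OF assms])
  then have "f = \<omega> (- v)"
    using skew[of _ v] by (simp add: fun_eq_iff bilinear_lneg[OF bilinear])
  then show thesis by (rule that)
qed

text \<open>
  Reflexivity of the space: a functional is \<open>\<omega> u\<close> for some \<open>u\<close>, and testing the antinorm bound at
  \<open>J u\<close> gives \<open>norm u \<le> norm y\<close>.  Then \<open>u\<close> is another point normed by \<open>f\<^sub>y\<close>, so \<open>u = y\<close> by strict
  convexity of the original norm.
\<close>

lemma norming_functional_antinorm_iff:
  "norming_functional (antinorm norm \<omega>) f (J y) \<longleftrightarrow> f = \<omega> y"
proof
  assume "f = \<omega> y"
  then show "norming_functional (antinorm norm \<omega>) f (J y)"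
    using linear_right pairing_le_antinorm
    by (simp add: norming_functional_def antinorm_J pairing_J_self)
next
  assume f: "norming_functional (antinorm norm \<omega>) f (J y)"
  then have "linear f" by (simp add: norming_functional_def)
  then obtain u where u: "f = \<omega> u"
    by (rule linear_functional_representation_left)
  have "\<omega> u (J u) \<le> norm y * norm u" and at_y: "\<omega> u (J y) = (norm y)\<^sup>2"
    using f u by (auto simp: norming_functional_def antinorm_J dest: spec[of _ "J u"])
  then have "norm u * norm u \<le> norm y * norm u"
    by (simp add: pairing_J_self power2_eq_square)
  then have "norm u \<le> norm y" by (cases "u = 0") auto
  then have "u = y"
    by (rule strictly_convex_norming_point_unique[OF strictly_convex norming_functional_J at_y])
  then show "f = \<omega> y" using u by simp
qed

text \<open>
  Since \<open>J\<close> is surjective, this says that \<open>J\<^sub>a = - J\<^sup>-\<^sup>1\<close>.  The sign comes from the skew symmetry: the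
  functional \<open>\<omega> y\<close> is the image of \<open>- y\<close> under \<open>G\<close>.
\<close>

lemma Ja_J: "Ja (J y) = - y"
proof -
  have "bdd_above {f x | x. antinorm norm \<omega> x = 1}" if f: "linear f" for f :: "'a \<Rightarrow> real"
  proof -
    obtain u where "f = \<omega> u"
      by (rule linear_functional_representation_left[OF f])
    then show ?thesis
      using pairing_le_antinorm[of u] by (intro bdd_aboveI[of _ "norm u"]) (clarsimp, metis mult.right_neutral)
  qed
  then have "duality_map (antinorm norm \<omega>) (J y) = \<omega> y"
    by (intro duality_map_eqI)
      (auto simp: antinorm_homogeneous antinorm_positive nontrivial norming_functional_antinorm_iff)
  also have "\<dots> = symplectic_dual \<omega> (- y)"
    using skew[of y] by (simp add: symplectic_dual_def fun_eq_iff bilinear_rneg[OF bilinear])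
  finally show ?thesis
    by (simp add: normality_map_def inv_f_f[OF inj_symplectic_dual])
qed

section \<open>Support functions as gauge functions\<close>

text \<open>
  The bipolar theorem in terms of the pairing.  If \<open>z / t \<notin> K\<close>, a functional that separates \<open>z / t\<close>
  from \<open>K\<close>, scaled so that it is at most 1 on \<open>K\<close>, is given by a point of the polar whose pairing
  with \<open>z\<close> exceeds \<open>t\<close>.
  The interior point \<open>0\<close> makes the supremum finite, and compactness of \<open>K\<close> makes it positive.
\<close>

lemma gauge_function_eq_Sup_polar:
  assumes K: "convex K" "compact K" "0 \<in> interior K" and z: "z \<noteq> 0"
  shows "gauge_function K z = Sup {\<omega> y z | y. \<forall>k\<in>K. \<omega> y k \<le> 1}"
proof -
  define P where "P = {y. \<forall>k\<in>K. \<omega> y k \<le> 1}"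
  define s where "s = Sup {\<omega> y z | y. y \<in> P}"
  have K0: "0 \<in> K" using K(3) interior_subset by blast
  have inside: "\<omega> y z \<le> t" if "y \<in> P" "t > 0" "(1 / t) *\<^sub>R z \<in> K" for y t
  proof -
    have "\<omega> y ((1 / t) *\<^sub>R z) \<le> 1" using that by (auto simp: P_def)
    then show ?thesis using that(2) by (simp add: bilinear_rmul[OF bilinear])
  qed
  obtain e where e: "e > 0" "cball 0 e \<subseteq> K"
    using K(3) by (meson mem_interior_cball)
  have "(1 / (norm z / e)) *\<^sub>R z \<in> K"
    using e z by (intro subsetD[OF e(2)]) simp
  then have "\<omega> y z \<le> norm z / e" if "y \<in> P" for y
    using inside[OF that, of "norm z / e"] e(1) z by simp
  then have bdd: "bdd_above {\<omega> y z | y. y \<in> P}"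
    by (intro bdd_aboveI[of _ "norm z / e"]) auto
  have upper: "\<omega> y z \<le> s" if "y \<in> P" for y
    unfolding s_def using that by (intro cSup_upper bdd) blast
  have "0 \<in> P" by (simp add: P_def bilinear_lzero[OF bilinear])
  then have s_nonneg: "s \<ge> 0" using upper[of 0] by (simp add: bilinear_lzero[OF bilinear])
  have mem: "(1 / t) *\<^sub>R z \<in> K \<longleftrightarrow> s \<le> t" if t: "t > 0" for t
  proof
    assume "(1 / t) *\<^sub>R z \<in> K"
    then show "s \<le> t"
      unfolding s_def using inside[OF _ t] \<open>0 \<in> P\<close> by (intro cSup_least) auto
  next
    assume "s \<le> t"
    show "(1 / t) *\<^sub>R z \<in> K"
    proof (rule ccontr)
      assume "(1 / t) *\<^sub>R z \<notin> K"
      then obtain f :: "'a \<Rightarrow> real" and c where f: "linear f"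
        and le: "\<And>k. k \<in> K \<Longrightarrow> f k \<le> c" and gt: "c < f ((1 / t) *\<^sub>R z)"
        using separation_compact_convex[OF K(1,2)] K0 by blast
      \<comment> \<open>A level strictly between the two sides is positive even when \<open>c = 0\<close>.\<close>
      define d where "d = (c + f ((1 / t) *\<^sub>R z)) / 2"
      have "0 \<le> c" using le[OF K0] linear_0[OF f] by simp
      then have d: "d > 0" "c < d" "d < f ((1 / t) *\<^sub>R z)"
        using gt by (auto simp: d_def)
      obtain u where u: "f = \<omega> u"
        by (rule linear_functional_representation_left[OF f])
      let ?y = "(1 / d) *\<^sub>R u"
      have "?y \<in> P"
        unfolding P_def using le d u by (fastforce simp: bilinear_lmul[OF bilinear])
      then have "\<omega> ?y z \<le> t" using upper \<open>s \<le> t\<close> by force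
      then show False
        using d t by (simp add: u bilinear_lmul[OF bilinear] bilinear_rmul[OF bilinear] field_simps)
    qed
  qed
  have "s \<noteq> 0"
  proof
    assume "s = 0"
    obtain R where R: "R > 0" "\<And>k. k \<in> K \<Longrightarrow> norm k \<le> R"
      using compact_imp_bounded[OF K(2)] unfolding bounded_pos by blast
    have "(1 / (norm z / (2 * R))) *\<^sub>R z \<in> K"
      using mem[of "norm z / (2 * R)"] R(1) z \<open>s = 0\<close> by simp
    \<comment> \<open>The point just found in \<open>K\<close> has norm \<open>2 * R\<close>.\<close>
    from R(2)[OF this] R(1) z show False by simp
  qed
  then have "gauge_function K z = s"
    using s_nonneg mem by (intro gauge_function_eqI z) auto
  then show ?thesis by (simp add: s_def P_def)
qed

lemma gauge_function_J_image: "gauge_function (J ` M) (J x) = gauge_function M x"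
proof -
  have "J x \<in> (*\<^sub>R) t ` J ` M \<longleftrightarrow> x \<in> (*\<^sub>R) t ` M" for t
    using inj_J by (auto simp: image_iff simp flip: J_scale dest: injD)
  then show ?thesis by (simp add: gauge_function_def)
qed

lemma normed_support_polar:
  assumes "convex (J ` M)" "compact (J ` M)" "0 \<in> interior (J ` M)" and x: "x \<noteq> 0"
  shows "normed_support norm (right_semipolar norm M) x = gauge_function M x"
proof -
  have "normed_support norm (right_semipolar norm M) x
      = Sup {\<omega> y (J x) | y. \<forall>k\<in>J ` M. \<omega> y k \<le> 1}"
    by (simp add: normed_support_def mem_symplectic_polar_iff pairing_J del: ball_simps)
  also have "\<dots> = gauge_function (J ` M) (J x)"
    using gauge_function_eq_Sup_polar[OF assms(1-3) J_nonzero[OF x]] by simp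
  also have "\<dots> = gauge_function M x"
    by (rule gauge_function_J_image)
  finally show ?thesis .
qed

lemma mem_Ja_image: "x \<in> Ja ` A \<longleftrightarrow> J (- x) \<in> A"
proof
  assume "x \<in> Ja ` A"
  then obtain a where a: "a \<in> A" "x = Ja a" by blast
  obtain y where "a = J y" using surj_J by blast
  then show "J (- x) \<in> A" using a by (simp add: Ja_J)
next
  assume "J (- x) \<in> A"
  then show "x \<in> Ja ` A" using Ja_J[of "- x"] by (metis image_eqI minus_minus)
qed

text \<open>
  By the formula for \<open>J\<^sub>a\<close> and homogeneity of \<open>J\<close>, the condition \<open>x / t \<in> J\<^sub>a M\<degree>\<close> bounds
  \<open>\<omega> k (J x)\<close> by \<open>t\<close> for every \<open>k \<in> J M\<close>, which is the condition that \<open>t\<close> bounds the support function.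
  The support function is positive at \<open>x\<close> because \<open>J M\<close> contains a positive multiple of \<open>x\<close>.
\<close>

lemma normed_support_J_image:
  assumes bounded: "bounded (J ` M)" and interior: "0 \<in> interior (J ` M)" and x: "x \<noteq> 0"
  shows "normed_support norm (J ` M) x = gauge_function (Ja ` right_semipolar norm M) x"
proof -
  define s where "s = Sup ((\<lambda>k. \<omega> k (J x)) ` (J ` M))"
  have bdd: "bdd_above ((\<lambda>k. \<omega> k (J x)) ` (J ` M))"
    using linear_functional_bdd_above[OF linear_left bounded, of "J x"]
    by (simp only: Setcompr_eq_image)
  have nonempty: "J ` M \<noteq> {}" using interior interior_subset by blast
  obtain e where e: "e > 0" "cball 0 e \<subseteq> J ` M"
    using interior by (meson mem_interior_cball)
  let ?k = "(e / norm x) *\<^sub>R x"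
  have "?k \<in> J ` M" using e x by (intro subsetD[OF e(2)]) simp
  then have "\<omega> ?k (J x) \<le> s"
    unfolding s_def by (intro cSup_upper bdd imageI)
  moreover have "\<omega> ?k (J x) > 0"
    using e(1) x by (simp add: bilinear_lmul[OF bilinear] pairing_J_self)
  ultimately have "s > 0" by linarith
  moreover have "(1 / t) *\<^sub>R x \<in> Ja ` right_semipolar norm M \<longleftrightarrow> s \<le> t" if t: "t > 0" for t
  proof -
    have "\<omega> (J (- ((1 / t) *\<^sub>R x))) k \<le> 1 \<longleftrightarrow> \<omega> k (J x) \<le> t" for k
      using t skew[of k "J x"] J_scale[of "- (1 / t)" x]
      by (simp add: bilinear_lmul[OF bilinear] bilinear_lneg[OF bilinear] minus_le_iff[of t] field_simps)
    then have "(1 / t) *\<^sub>R x \<in> Ja ` right_semipolar norm M \<longleftrightarrow> (\<forall>k\<in>J ` M. \<omega> k (J x) \<le> t)"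
      unfolding mem_Ja_image mem_symplectic_polar_iff by simp
    also have "\<dots> \<longleftrightarrow> s \<le> t"
      unfolding s_def using cSup_le_iff[OF _ bdd] nonempty by auto
    finally show ?thesis .
  qed
  ultimately have "gauge_function (Ja ` right_semipolar norm M) x = s"
    by (intro gauge_function_eqI x)
  then show ?thesis
    by (simp add: normed_support_def s_def pairing_J Setcompr_eq_image)
qed

end

section \<open>The duality theorem\<close>

theorem theorem5p5:
  fixes \<omega> :: "'a::real_normed_vector \<Rightarrow> 'a \<Rightarrow> real" and M :: "'a set"
  defines "J \<equiv> normality_map norm \<omega>"
    and "Ja \<equiv> normality_map (antinorm norm \<omega>) \<omega>"
    and "Mpolar \<equiv> right_semipolar norm M"
  assumes "\<exists>B::'a set. finite B \<and> span B = UNIV"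
    and "even (dim (UNIV :: 'a set))"
    and "smooth_space TYPE('a)"
    and "strictly_convex_space TYPE('a)"
    and "symplectic_form \<omega>"
    and "convex_body M" and "0 \<in> interior M"
    and "convex_body (J ` M)" and "0 \<in> interior (J ` M)"
    and "convex_body (Ja ` Mpolar)" and "0 \<in> interior (Ja ` Mpolar)"
  shows "\<forall>x. x \<noteq> 0 \<longrightarrow>
           normed_support norm Mpolar x = gauge_function M x \<and>
           normed_support norm (J ` M) x = gauge_function (Ja ` Mpolar) x"
proof (intro allI impI)
  fix x :: 'a assume x: "x \<noteq> 0"
  \<comment> \<open>The body \<open>M\<close> is a compact neighbourhood of \<open>0\<close>.\<close>
  have "compact (cball (0::'a) 1)"
    using assms(9,10) by (intro compact_cball_of_compact_neighbourhood) (auto simp: convex_body_def)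
  then interpret symplectic_minkowski_space \<omega>
    using assms(4,6-8) x by unfold_locales auto
  have JM: "convex (J ` M)" "compact (J ` M)" "0 \<in> interior (J ` M)"
    using assms(11,12) by (auto simp: convex_body_def)
  show "normed_support norm Mpolar x = gauge_function M x \<and>
        normed_support norm (J ` M) x = gauge_function (Ja ` Mpolar) x"
    using normed_support_polar[OF JM[unfolded J_def] x]
      normed_support_J_image[OF compact_imp_bounded[OF JM(2)[unfolded J_def]] JM(3)[unfolded J_def] x]
    by (simp add: J_def Ja_def Mpolar_def)
qed

end
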